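(* Let $A$ be the adjacency matrix of a doubly regular tournament on $n$ vertices, and let $A'=J-I-A$. Then the incidence structure $(\mathcal{V}_A,\mathcal{B}_A\cup\mathcal{B}_{A'})$ is a $2$-$(n,\frac{n-1}{2},\frac{n-3}{2})$ design and a $3$-$(n,\frac{n-1}{2},\frac{n-7}{4})$ adesign.
   Context: $J$ denotes the all-one matrix and $I$ the identity matrix. A tournament on $n$ vertices is a directed graph in which every pair of distinct vertices is joined by exactly one arc; its adjacency matrix $A$ has $(A)_{xy}=1$ iff there is an arc $xy$. It is doubly regular if every vertex has in-degree and out-degree $\frac{n-1}{2}$, and every pair of distinct vertices has exactly $\frac{n-3}{4}$ common out-neighbours and the same number of common in-neighbours. For a $0$-$1$ matrix $M$ with rows and columns indexed by the vertex set, $\mathcal{V}_M$ denotes the set indexing the columns and $\mathcal{B}_M$ the collection of supports of the rows of $M$ (one block per row); the union is the collection of all these $2n$ blocks. A $t$-$(v,k,\lambda)$ design has $v$ points, all blocks of size $k$, and every $t$-subset of points in exactly $\lambda$ blocks. A $t$-$(v,k,\lambda)$ adesign has $v$ points, all blocks of size $k$, every $t$-subset in either $\lambda$ or $\lambda+1$ blocks for a positive integer $\lambda$, and is not a $t$-design.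
   Formalization: The 3-adesign claim is made only for n > 7, because an adesign needs a positive λ and (n-7)/4 is zero or negative for n = 1, 3, 7, where the claim fails; the 2-design claim is stated for all n. *)

theory Defs
  imports "HOL-Analysis.Analysis" "HOL-Library.Multiset" "Graph_Theory.Digraph"
begin

definition tournament :: "('v, 'b) pre_digraph \<Rightarrow> bool" where
  "tournament G \<longleftrightarrow> digraph G \<and>
     (\<forall>x\<in>verts G. \<forall>y\<in>verts G. x \<noteq> y \<longrightarrow>
        (\<exists>!e. e \<in> arcs G \<and> arc_to_ends G e \<in> {(x, y), (y, x)}))"

text \<open>
  The parameters are compared as real numbers, so no truncated subtraction or division occurs;
  a doubly regular tournament with at least two vertices therefore has order congruent to 3
  modulo 4.
\<close>

definition doubly_regular_tournament :: "('v, 'b) pre_digraph \<Rightarrow> bool" where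
  "doubly_regular_tournament G \<longleftrightarrow> tournament G \<and>
     (\<forall>x\<in>verts G.
        real (out_degree G x) = (real (card (verts G)) - 1) / 2 \<and>
        real (in_degree G x) = (real (card (verts G)) - 1) / 2) \<and>
     (\<forall>x\<in>verts G. \<forall>y\<in>verts G. x \<noteq> y \<longrightarrow>
        real (card {z \<in> verts G. x \<rightarrow>\<^bsub>G\<^esub> z \<and> y \<rightarrow>\<^bsub>G\<^esub> z}) = (real (card (verts G)) - 3) / 4 \<and>
        real (card {z \<in> verts G. z \<rightarrow>\<^bsub>G\<^esub> x \<and> z \<rightarrow>\<^bsub>G\<^esub> y}) = (real (card (verts G)) - 3) / 4)"

text \<open>Matrices are indexed by the vertex type, so this is used for digraphs \<open>G\<close> with \<open>verts G = UNIV\<close>.\<close>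

definition adjacency_matrix :: "('v::finite, 'b) pre_digraph \<Rightarrow> int ^ 'v ^ 'v" where
  "adjacency_matrix G = (\<chi> x y. if x \<rightarrow>\<^bsub>G\<^esub> y then 1 else 0)"

definition all_one_matrix :: "int ^ 'v ^ 'v" where
  "all_one_matrix = (\<chi> x y. 1)"

text \<open>Blocks form a multiset, since different rows may have the same support.\<close>

definition row_support :: "int ^ 'v ^ 'w \<Rightarrow> 'w \<Rightarrow> 'v set" where
  "row_support M x = {y. M $ x $ y \<noteq> 0}"

definition row_blocks :: "int ^ 'v ^ 'w::finite \<Rightarrow> 'v set multiset" where
  "row_blocks M = image_mset (row_support M) (mset_set UNIV)"

definition blocks_containing :: "'a set multiset \<Rightarrow> 'a set \<Rightarrow> nat" where
  "blocks_containing B T = size {#b \<in># B. T \<subseteq> b#}"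

definition uniform_blocks :: "nat \<Rightarrow> nat \<Rightarrow> 'a set \<Rightarrow> 'a set multiset \<Rightarrow> bool" where
  "uniform_blocks v k V B \<longleftrightarrow> finite V \<and> card V = v \<and> (\<forall>b\<in>#B. b \<subseteq> V \<and> card b = k)"

definition t_design :: "nat \<Rightarrow> nat \<Rightarrow> nat \<Rightarrow> nat \<Rightarrow> 'a set \<Rightarrow> 'a set multiset \<Rightarrow> bool" where
  "t_design t v k l V B \<longleftrightarrow> uniform_blocks v k V B \<and>
     (\<forall>T. T \<subseteq> V \<and> card T = t \<longrightarrow> blocks_containing B T = l)"

definition t_adesign :: "nat \<Rightarrow> nat \<Rightarrow> nat \<Rightarrow> nat \<Rightarrow> 'a set \<Rightarrow> 'a set multiset \<Rightarrow> bool" where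
  "t_adesign t v k l V B \<longleftrightarrow> 0 < l \<and> uniform_blocks v k V B \<and>
     (\<forall>T. T \<subseteq> V \<and> card T = t \<longrightarrow> blocks_containing B T \<in> {l, l + 1}) \<and>
     \<not> (\<exists>m. t_design t v k m V B)"

end

(* For a vertex z outside a triple {a, b, c}, let x, y, w be the 0-1 values of the arcs from z to
   a, b, c.  The identity  xyw + (1-x)(1-y)(1-w) = 1 - x - y - w + xy + yw + xw  reduces the number
   of blocks containing the triple to degrees and common in-neighbours of pairs.  The only dependence
   on the triple comes from z in {a, b, c}: it is the number of sinks of the triple, which is 1 for
   a transitive and 0 for a cyclic triple.  Both kinds of triple occur, so the counts are not
   constant. *)

theory Submission
  imports Defs
begin

lemma blocks_containing_plus:
  "blocks_containing (B + C) T = blocks_containing B T + blocks_containing C T"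
  by (simp add: blocks_containing_def)

lemma blocks_containing_row_blocks:
  "blocks_containing (row_blocks M) T = card {z. T \<subseteq> row_support M z}"
  by (simp add: blocks_containing_def row_blocks_def filter_mset_image_mset)

lemma set_mset_row_blocks: "set_mset (row_blocks M) = range (row_support M)"
  by (simp add: row_blocks_def)

lemma row_support_adjacency_matrix:
  "row_support (adjacency_matrix G) x = {y. x \<rightarrow>\<^bsub>G\<^esub> y}"
  by (simp add: row_support_def adjacency_matrix_def)

text \<open>The diagonal entries of $J-I-A$ are \<open>1 - 1 - A $ x $ x\<close>, hence nonzero
  exactly at loops; this is why the diagonal case is not simply empty for arbitrary
  \<open>G\<close>.\<close>

lemma row_support_complement:
  "row_support (all_one_matrix - mat 1 - adjacency_matrix G) x =
    {y. if x = y then x \<rightarrow>\<^bsub>G\<^esub> y else \<not> x \<rightarrow>\<^bsub>G\<^esub> y}"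
  by (auto simp: row_support_def adjacency_matrix_def all_one_matrix_def mat_def)

context nomulti_digraph
begin

text \<open>Degrees count arcs, while row supports collect vertices. Without parallel arcs
  \<open>head G\<close> is injective on the arcs leaving \<open>x\<close>, so the two counts
  agree.\<close>

lemma out_degree_eq_card: "out_degree G x = card {y. x \<rightarrow> y}"
proof -
  have "bij_betw (head G) (out_arcs G x) {y. x \<rightarrow> y}"
    unfolding bij_betw_def
  proof
    show "inj_on (head G) (out_arcs G x)"
      using no_multi_arcs by (auto simp: inj_on_def arc_to_ends_def)
    show "head G ` out_arcs G x = {y. x \<rightarrow> y}"
      by (force simp: arcs_ends_def arc_to_ends_def image_iff)
  qed
  then show ?thesis
    by (simp add: out_degree_def bij_betw_same_card)
qed

lemma in_degree_eq_card: "in_degree G x = card {y. y \<rightarrow> x}"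
proof -
  have "bij_betw (tail G) (in_arcs G x) {y. y \<rightarrow> x}"
    unfolding bij_betw_def
  proof
    show "inj_on (tail G) (in_arcs G x)"
      using no_multi_arcs by (auto simp: inj_on_def arc_to_ends_def)
    show "tail G ` in_arcs G x = {y. y \<rightarrow> x}"
      by (force simp: arcs_ends_def arc_to_ends_def image_iff)
  qed
  then show ?thesis
    by (simp add: in_degree_def bij_betw_same_card)
qed

end

lemma tournament_irrefl:
  assumes "tournament G"
  shows "\<not> x \<rightarrow>\<^bsub>G\<^esub> x"
proof -
  interpret digraph G
    using assms by (simp add: tournament_def)
  show ?thesis
    using adj_not_same by blast
qed

lemma tournament_asym_total:
  assumes "tournament G" "x \<in> verts G" "y \<in> verts G" "x \<noteq> y"
  shows "y \<rightarrow>\<^bsub>G\<^esub> x \<longleftrightarrow> \<not> x \<rightarrow>\<^bsub>G\<^esub> y"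
proof -
  have "\<exists>!e. e \<in> arcs G \<and> arc_to_ends G e \<in> {(x, y), (y, x)}"
    using assms by (simp add: tournament_def)
  then show ?thesis
    using \<open>x \<noteq> y\<close> unfolding arcs_ends_def image_iff by (metis Pair_inject insert_iff singletonD)
qed

text \<open>The digraph is reduced to a relation on a finite type, and the parameters are cleared of
  fractions and differences, so that arithmetic on naturals stays exact and linear.\<close>

locale doubly_regular =
  fixes R :: "'v::finite \<Rightarrow> 'v \<Rightarrow> bool" (infix "\<leadsto>" 50)
  assumes irrefl: "\<not> x \<leadsto> x"
    and asym_total: "x \<noteq> y \<Longrightarrow> y \<leadsto> x \<longleftrightarrow> \<not> x \<leadsto> y"
    and card_out: "2 * card {y. x \<leadsto> y} + 1 = CARD('v)"
    and card_in: "2 * card {y. y \<leadsto> x} + 1 = CARD('v)"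
    and card_common_out: "x \<noteq> y \<Longrightarrow> 4 * card {z. x \<leadsto> z \<and> y \<leadsto> z} + 3 = CARD('v)"
    and card_common_in: "x \<noteq> y \<Longrightarrow> 4 * card {z. z \<leadsto> x \<and> z \<leadsto> y} + 3 = CARD('v)"
begin

text \<open>This is the number of blocks through \<open>T\<close>: rows of $A$ give
  out-neighbourhoods and rows of $A'$ give in-neighbourhoods.\<close>

definition dominating_count :: "'v set \<Rightarrow> nat" where
  "dominating_count T = card {z. \<forall>t\<in>T. z \<leadsto> t} + card {z. \<forall>t\<in>T. t \<leadsto> z}"

lemma dominating_count_pair:
  assumes "x \<noteq> y"
  shows "2 * dominating_count {x, y} + 3 = CARD('v)"
  using card_common_out[OF assms] card_common_in[OF assms] by (simp add: dominating_count_def)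

definition sinks :: "'v \<Rightarrow> 'v \<Rightarrow> 'v \<Rightarrow> nat" where
  "sinks a b c = of_bool (b \<leadsto> a \<and> c \<leadsto> a) + of_bool (a \<leadsto> b \<and> c \<leadsto> b) + of_bool (a \<leadsto> c \<and> b \<leadsto> c)"

text \<open>Summing the identity over all $n$ vertices yields $n - 3(n-1)/2 + 3(n-3)/4 =
  (n-3)/4$.\<close>

lemma dominating_count_triple:
  assumes "a \<noteq> b" "a \<noteq> c" "b \<noteq> c"
  shows "4 * (dominating_count {a, b, c} + sinks a b c) + 3 = CARD('v)"
proof -
  \<comment> \<open>Negative terms are moved across to stay within the naturals. At
    \<open>z = a\<close> the true value of \<open>a \<leadsto> z\<close> is false, whereas
    $(1-x)(1-y)(1-w)$ is 1 if \<open>a\<close> is a sink; the bracketed terms on the left restore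
    this difference.\<close>
  have pointwise:
    "(\<lambda>z. of_bool (z \<leadsto> a \<and> z \<leadsto> b \<and> z \<leadsto> c) + of_bool (a \<leadsto> z \<and> b \<leadsto> z \<and> c \<leadsto> z)
      + (of_bool (z = a \<and> b \<leadsto> a \<and> c \<leadsto> a) + of_bool (z = b \<and> a \<leadsto> b \<and> c \<leadsto> b)
        + of_bool (z = c \<and> a \<leadsto> c \<and> b \<leadsto> c))
      + of_bool (z \<leadsto> a) + of_bool (z \<leadsto> b) + of_bool (z \<leadsto> c))
    = (\<lambda>z. 1 + of_bool (z \<leadsto> a \<and> z \<leadsto> b) + of_bool (z \<leadsto> a \<and> z \<leadsto> c)
      + (of_bool (z \<leadsto> b \<and> z \<leadsto> c) :: nat))" (is "?lhs = ?rhs")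
  proof
    fix z
    show "?lhs z = ?rhs z"
    proof (cases "z \<in> {a, b, c}")
      case True
      then show ?thesis
        using assms asym_total[of a b] asym_total[of a c] asym_total[of b c]
        by (auto simp: irrefl)
    next
      case False
      then show ?thesis
        using asym_total[of z a] asym_total[of z b] asym_total[of z c] by auto
    qed
  qed
  have point: "(\<Sum>z\<in>UNIV. of_bool (z = t \<and> P)) = (of_bool P :: nat)" for t :: 'v and P
    by (cases P) (simp_all add: of_bool_def)
  have card: "(\<Sum>z\<in>UNIV. of_bool (P z)) = card {z. P z}" for P :: "'v \<Rightarrow> bool"
    by (simp add: Collect_conj_eq)
  have "dominating_count {a, b, c} + sinks a b c
      + card {z. z \<leadsto> a} + card {z. z \<leadsto> b} + card {z. z \<leadsto> c}
    = CARD('v) + card {z. z \<leadsto> a \<and> z \<leadsto> b} + card {z. z \<leadsto> a \<and> z \<leadsto> c}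
      + card {z. z \<leadsto> b \<and> z \<leadsto> c}"
    using arg_cong[OF pointwise, of "\<lambda>f. sum f UNIV"]
    unfolding sum.distrib point card
    by (simp add: dominating_count_def sinks_def split del: split_of_bool)
  then show ?thesis
    using card_in[of a] card_in[of b] card_in[of c] card_common_in[OF assms(1)]
      card_common_in[OF assms(2)] card_common_in[OF assms(3)]
    by simp
qed

text \<open>Two vertices of a triple cannot both be sinks, since only one of them receives the arc
  joining them.\<close>

lemma sinks_le_1:
  assumes "a \<noteq> b" "a \<noteq> c" "b \<noteq> c"
  shows "sinks a b c \<le> 1"
  using assms asym_total[of a b] asym_total[of a c] asym_total[of b c]
  by (auto simp: sinks_def)

text \<open>Any vertex has out-degree at least 2 here. It is the source of a triple with two of its
  out-neighbours, and the arc between these determines the unique sink.\<close>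

lemma ex_transitive_triple:
  assumes "CARD('v) > 3"
  shows "\<exists>a b c. a \<noteq> b \<and> a \<noteq> c \<and> b \<noteq> c \<and> sinks a b c = 1"
proof -
  fix a :: 'v
  have "\<not> card {y. a \<leadsto> y} \<le> Suc 0"
    using card_out[of a] assms by linarith
  then obtain b c where "a \<leadsto> b" "a \<leadsto> c" "b \<noteq> c"
    by (auto simp: card_le_Suc0_iff_eq)
  moreover from this have "a \<noteq> b" "a \<noteq> c"
    using irrefl by auto
  ultimately show ?thesis
    using asym_total[of a b] asym_total[of a c] asym_total[of b c]
    by (intro exI[of _ a] exI[of _ b] exI[of _ c]) (auto simp: sinks_def)
qed

(* An arc from a to b in no cyclic triple would make every out-neighbour of b an out-neighbour
   of a, giving the pair too many common out-neighbours. *)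
lemma ex_cyclic_triple:
  assumes "CARD('v) > 1"
  shows "\<exists>a b c. a \<noteq> b \<and> a \<noteq> c \<and> b \<noteq> c \<and> sinks a b c = 0"
proof -
  fix a :: 'v
  have "card {y. a \<leadsto> y} \<noteq> 0"
    using card_out[of a] assms by linarith
  then obtain b where "a \<leadsto> b"
    by (auto simp: card_eq_0_iff)
  then have "a \<noteq> b"
    using irrefl by auto
  have "card {z. a \<leadsto> z \<and> b \<leadsto> z} \<noteq> card {z. b \<leadsto> z}"
    using card_common_out[OF \<open>a \<noteq> b\<close>] card_out[of b] assms by linarith
  then obtain c where "b \<leadsto> c" "\<not> a \<leadsto> c"
    by metis
  moreover from this have "b \<noteq> c" "a \<noteq> c"
    using irrefl \<open>a \<leadsto> b\<close> \<open>a \<noteq> b\<close> asym_total by blast+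
  ultimately show ?thesis
    using \<open>a \<leadsto> b\<close> \<open>a \<noteq> b\<close> asym_total[of a b] asym_total[of a c] asym_total[of b c]
    by (intro exI[of _ a] exI[of _ b] exI[of _ c]) (auto simp: sinks_def)
qed

end

lemma doubly_regular_of_tournament:
  fixes G :: "('v::finite, 'b) pre_digraph"
  assumes "verts G = UNIV" "doubly_regular_tournament G"
  shows "doubly_regular (\<lambda>x y. x \<rightarrow>\<^bsub>G\<^esub> y)"
proof -
  have T: "tournament G"
    using assms(2) by (simp add: doubly_regular_tournament_def)
  interpret digraph G
    using T by (simp add: tournament_def)
  show ?thesis
  proof
    show "\<not> x \<rightarrow>\<^bsub>G\<^esub> x" for x
      by (rule tournament_irrefl[OF T])
    show "y \<rightarrow>\<^bsub>G\<^esub> x \<longleftrightarrow> \<not> x \<rightarrow>\<^bsub>G\<^esub> y" if "x \<noteq> y" for x y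
      using that assms(1) by (intro tournament_asym_total[OF T]) simp_all
    \<comment> \<open>Injectivity of the embedding into the reals brings the parameters back to
      equations over the naturals.\<close>
    have half: "2 * c + 1 = m" if "real c = (real m - 1) / 2" for c m
      using that by (subst of_nat_eq_iff[where 'a = real, symmetric]) simp
    have quarter: "4 * c + 3 = m" if "real c = (real m - 3) / 4" for c m
      using that by (subst of_nat_eq_iff[where 'a = real, symmetric]) simp
    show "2 * card {y. x \<rightarrow>\<^bsub>G\<^esub> y} + 1 = CARD('v)" "2 * card {y. y \<rightarrow>\<^bsub>G\<^esub> x} + 1 = CARD('v)" for x
      using assms unfolding doubly_regular_tournament_def
      by (intro half; simp add: out_degree_eq_card in_degree_eq_card)+
    show "4 * card {z. x \<rightarrow>\<^bsub>G\<^esub> z \<and> y \<rightarrow>\<^bsub>G\<^esub> z} + 3 = CARD('v)"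
      "4 * card {z. z \<rightarrow>\<^bsub>G\<^esub> x \<and> z \<rightarrow>\<^bsub>G\<^esub> y} + 3 = CARD('v)" if "x \<noteq> y" for x y
      using assms that unfolding doubly_regular_tournament_def by (intro quarter; simp)+
  qed
qed

theorem theorem2:
  fixes G :: "('v::finite, 'b) pre_digraph" and A A' :: "int ^ 'v ^ 'v" and n :: nat
  assumes "verts G = UNIV" and "n = card (verts G)"
    and "doubly_regular_tournament G"
    and "A = adjacency_matrix G"
    and "A' = all_one_matrix - mat 1 - A"
  shows "t_design 2 n ((n - 1) div 2) ((n - 3) div 2) UNIV (row_blocks A + row_blocks A') \<and>
    (n > 7 \<longrightarrow>
      t_adesign 3 n ((n - 1) div 2) ((n - 7) div 4) UNIV (row_blocks A + row_blocks A'))"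
proof -
  interpret doubly_regular "\<lambda>x y. x \<rightarrow>\<^bsub>G\<^esub> y"
    using assms(1,3) by (rule doubly_regular_of_tournament)
  have n: "n = CARD('v)"
    using assms(1,2) by simp
  let ?B = "row_blocks A + row_blocks A'"
  have A: "row_support A x = {y. x \<rightarrow>\<^bsub>G\<^esub> y}" for x
    by (simp add: assms(4) row_support_adjacency_matrix)
  \<comment> \<open>In a tournament $A'$ is the transpose of $A$: reversing an arc is the same as
    negating adjacency off the diagonal, and there are no loops.\<close>
  have "y \<rightarrow>\<^bsub>G\<^esub> x \<longleftrightarrow> (if x = y then x \<rightarrow>\<^bsub>G\<^esub> y else \<not> x \<rightarrow>\<^bsub>G\<^esub> y)" for x y
    using asym_total[of x y] by auto
  then have A': "row_support A' x = {y. y \<rightarrow>\<^bsub>G\<^esub> x}" for x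
    unfolding assms(4,5) row_support_complement by simp
  have count: "blocks_containing ?B T = dominating_count T" for T
    by (simp add: blocks_containing_plus blocks_containing_row_blocks A A' dominating_count_def
        subset_iff Ball_def)
  have "card {y. x \<rightarrow>\<^bsub>G\<^esub> y} = (n - 1) div 2" "card {y. y \<rightarrow>\<^bsub>G\<^esub> x} = (n - 1) div 2" for x
    using card_out[of x] card_in[of x] n by linarith+
  then have uniform: "uniform_blocks n ((n - 1) div 2) UNIV ?B"
    by (auto simp: uniform_blocks_def n set_mset_row_blocks A A')
  have "dominating_count T = (n - 3) div 2" if "card T = 2" for T
    using that dominating_count_pair n by (fastforce simp: card_2_iff)
  with uniform have design: "t_design 2 n ((n - 1) div 2) ((n - 3) div 2) UNIV ?B"
    by (simp add: t_design_def count)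
  \<comment> \<open>For $n = 7$ the lower index would be 0, which the definition of an adesign
    excludes.\<close>
  have "t_adesign 3 n ((n - 1) div 2) ((n - 7) div 4) UNIV ?B" if "n > 7"
  proof -
    \<comment> \<open>The total $(n-3)/4$ is the larger of the two block counts;
      \<open>n > 7\<close> keeps \<open>n - 7\<close> from being truncated.\<close>
    have quotient: "s = (n - 7) div 4 + 1" if "4 * s + 3 = n" for s
      using that \<open>n > 7\<close> by presburger
    have triple: "dominating_count {a, b, c} + sinks a b c = (n - 7) div 4 + 1"
      if "a \<noteq> b" "a \<noteq> c" "b \<noteq> c" for a b c
      using dominating_count_triple[OF that] n by (intro quotient) simp
    have "dominating_count T \<in> {(n - 7) div 4, (n - 7) div 4 + 1}" if T: "card T = 3" for T
    proof -
      obtain a b c where abc: "T = {a, b, c}" "a \<noteq> b" "a \<noteq> c" "b \<noteq> c"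
        using T by (auto simp: card_3_iff)
      show ?thesis
        using triple[OF abc(2-4)] sinks_le_1[OF abc(2-4)] unfolding abc(1) insert_iff by linarith
    qed
    moreover have "\<not> t_design 3 n ((n - 1) div 2) m UNIV ?B" for m
    proof
      assume "t_design 3 n ((n - 1) div 2) m UNIV ?B"
      then have const: "sinks a b c + m = (n - 7) div 4 + 1" if "a \<noteq> b" "a \<noteq> c" "b \<noteq> c" for a b c
        using triple[OF that] that by (auto simp: t_design_def count)
      obtain a b c where transitive: "a \<noteq> b" "a \<noteq> c" "b \<noteq> c" "sinks a b c = 1"
        using ex_transitive_triple \<open>n > 7\<close> n by auto
      obtain a' b' c' where cyclic: "a' \<noteq> b'" "a' \<noteq> c'" "b' \<noteq> c'" "sinks a' b' c' = 0"
        using ex_cyclic_triple \<open>n > 7\<close> n by auto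
      show False
        using const[OF transitive(1-3)] const[OF cyclic(1-3)] transitive(4) cyclic(4) by simp
    qed
    \<comment> \<open>The bound \<open>n > 7\<close> alone allows 8, 9 and 10. The equation for any
      one triple shows that $n$ is 3 modulo 4, hence at least 11.\<close>
    moreover have "0 < (n - 7) div 4"
    proof -
      obtain a b c :: 'v where "a \<noteq> b" "a \<noteq> c" "b \<noteq> c"
        using ex_transitive_triple \<open>n > 7\<close> n by auto
      from dominating_count_triple[OF this] show ?thesis
        using n \<open>n > 7\<close> unfolding div_greater_zero_iff by presburger
    qed
    ultimately show ?thesis
      using uniform by (simp add: t_adesign_def count)
  qed
  with design show ?thesis
    by blast
qed

end
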